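(* Let $\kappa>0$ be a real number, let $\gamma$ be Euler's constant, and define $$g_{\kappa}(x):=e^{-e^{-[(\kappa-1)x+\kappa\gamma]}},\quad x\in\mathbb{R}.$$ (i) If $\kappa<1$, then $\inf_{x\in\mathbb{R}}g_{\kappa}(x)=\lim_{x\to\infty}g_{\kappa}(x)=0$. (ii) If $\kappa>1$, then $\inf_{x\in\mathbb{R}}g_{\kappa}(x)=\lim_{x\to-\infty}g_{\kappa}(x)=0$. (iii) If $\kappa=1$, then $g_{\kappa}(x)=e^{-e^{-\gamma}}>\frac12$ for all $x\in\mathbb{R}$.
   Context: $\gamma=\lim_{n\to\infty}\left(\sum_{k=1}^n\frac1k-\ln n\right)$ is Euler's constant. Origin of $g_\kappa$: if $X_{\mu,\beta}$ is a Gumbel random variable with parameters $\mu\in\mathbb{R},\beta>0$, i.e. with density $\frac1\beta e^{-z-e^{-z}}$, $z=\frac{x-\mu}{\beta}$, $x\in\mathbb{R}$, whose expectation is $\mu+\beta\gamma$, then $P(X_{\mu,\beta}\leq\kappa E[X_{\mu,\beta}])=g_\kappa(\mu/\beta)$. *)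

theory Defs
  imports "HOL-Analysis.Analysis"
begin

definition g :: "real \<Rightarrow> real \<Rightarrow> real" where
  "g \<kappa> x = exp (- exp (- ((\<kappa> - 1) * x + \<kappa> * euler_mascheroni)))"

text \<open>
  The infimum over the real line is always that of a nonempty set bounded below, so the
  conditionally complete \<^const>\<open>Inf\<close> on the reals is the genuine infimum here.
\<close>

lemma bdd_below_range_g: "bdd_below (range (g \<kappa>))"
  by (rule bdd_belowI[of _ 0]) (auto simp: g_def)

end

theory Submission
  imports Defs
begin

text \<open>
  The function \<open>g \<kappa>\<close> is the distribution function of the standard Gumbel law composed with the
  affine map \<open>x \<mapsto> (\<kappa> - 1) x + \<kappa> \<gamma>\<close>. For \<open>\<kappa> \<noteq> 1\<close> this map sends one of the two ends of the line
  to \<open>-\<infinity>\<close>, where a distribution function tends to its infimum \<open>0\<close>. For \<open>\<kappa> = 1\<close> it is constantly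
  \<open>\<gamma>\<close>, the mean of the law, which exceeds its median \<open>- ln (ln 2)\<close> because
  \<open>e\<^sup>\<gamma> \<ge> 1 + \<gamma> > 3/2 \<ge> 1 / ln 2\<close>.
\<close>

lemma cINF_eq_limit_of_lower_bound:
  fixes f :: "'a \<Rightarrow> 'b::{conditionally_complete_linorder, linorder_topology}"
  assumes lim: "(f \<longlongrightarrow> l) F" and "F \<noteq> bot"
    and eventually_in: "eventually (\<lambda>x. x \<in> A) F"
    and lower: "\<And>x. x \<in> A \<Longrightarrow> l \<le> f x"
  shows "(INF x\<in>A. f x) = l"
proof (rule antisym)
  have "bdd_below (f ` A)"
    using lower by (rule bdd_belowI2)
  then have "eventually (\<lambda>x. (INF x\<in>A. f x) \<le> f x) F"
    using eventually_in by (auto elim: eventually_mono intro: cINF_lower)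
  then show "(INF x\<in>A. f x) \<le> l"
    using tendsto_lowerbound[OF lim] \<open>F \<noteq> bot\<close> by blast
  have "A \<noteq> {}"
    using eventually_in \<open>F \<noteq> bot\<close> by auto
  then show "l \<le> (INF x\<in>A. f x)"
    using lower by (rule cINF_greatest)
qed

definition gumbel_cdf :: "real \<Rightarrow> real" where
  "gumbel_cdf z = exp (- exp (- z))"

lemma gumbel_cdf_pos: "0 < gumbel_cdf z"
  by (simp add: gumbel_cdf_def)

lemma gumbel_cdf_at_bot: "(gumbel_cdf \<longlongrightarrow> 0) at_bot"
proof -
  have "filterlim (\<lambda>z :: real. exp (- z)) at_top at_bot"
    by (rule filterlim_compose[OF exp_at_top filterlim_uminus_at_top_at_bot])
  then have "filterlim (\<lambda>z :: real. - exp (- z)) at_bot at_bot"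
    by (rule filterlim_compose[OF filterlim_uminus_at_bot_at_top])
  then show ?thesis
    unfolding gumbel_cdf_def by (rule filterlim_compose[OF exp_at_bot])
qed

lemma gumbel_cdf_gt_half_iff: "1/2 < gumbel_cdf z \<longleftrightarrow> exp (- z) < ln 2"
proof -
  have "1/2 < gumbel_cdf z \<longleftrightarrow> exp (- ln 2) < exp (- exp (- z))"
    by (simp add: gumbel_cdf_def exp_minus)
  then show ?thesis
    by simp
qed

lemma gumbel_cdf_euler_mascheroni_gt_half: "1/2 < gumbel_cdf euler_mascheroni"
proof -
  have "(3/2 :: real) < 1 + euler_mascheroni"
    using euler_mascheroni_gt_19_over_33 by simp
  also have "\<dots> \<le> exp euler_mascheroni"
    by (rule exp_ge_add_one_self)
  finally have "exp (- euler_mascheroni) < (2/3 :: real)"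
    by (simp add: exp_minus field_simps)
  also have "\<dots> \<le> ln 2"
    by (rule ln2_ge_two_thirds)
  finally show ?thesis
    by (simp only: gumbel_cdf_gt_half_iff)
qed

lemma g_eq_gumbel_cdf: "g \<kappa> x = gumbel_cdf ((\<kappa> - 1) * x + \<kappa> * euler_mascheroni)"
  by (simp add: g_def gumbel_cdf_def)

lemma tendsto_g_0_if_linear_part_at_bot:
  assumes "filterlim (\<lambda>x. (\<kappa> - 1) * x) at_bot F"
  shows "(g \<kappa> \<longlongrightarrow> 0) F"
proof -
  have "filterlim (\<lambda>x. (\<kappa> - 1) * x + \<kappa> * euler_mascheroni) at_bot F"
    using assms by (simp add: add.commute filterlim_tendsto_add_at_bot_iff[OF tendsto_const])
  then show ?thesis
    unfolding g_eq_gumbel_cdf by (rule filterlim_compose[OF gumbel_cdf_at_bot])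
qed

lemma tendsto_g_0_at_top:
  assumes "\<kappa> < 1"
  shows "(g \<kappa> \<longlongrightarrow> 0) at_top"
  using assms
  by (intro tendsto_g_0_if_linear_part_at_bot
      filterlim_tendsto_neg_mult_at_bot[OF tendsto_const] filterlim_ident) simp

lemma tendsto_g_0_at_bot:
  assumes "1 < \<kappa>"
  shows "(g \<kappa> \<longlongrightarrow> 0) at_bot"
  using assms
  by (intro tendsto_g_0_if_linear_part_at_bot
      filterlim_tendsto_pos_mult_at_bot[OF tendsto_const] filterlim_ident) simp

lemma INF_g_eq_0_if_tendsto_0:
  assumes "(g \<kappa> \<longlongrightarrow> 0) F" and "F \<noteq> bot"
  shows "(INF x\<in>UNIV. g \<kappa> x) = 0"
  by (rule cINF_eq_limit_of_lower_bound[OF assms])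
    (simp_all add: g_eq_gumbel_cdf gumbel_cdf_pos less_imp_le)

theorem proposition3p2:
  fixes \<kappa> :: real
  assumes "\<kappa> > 0"
  shows "(\<kappa> < 1 \<longrightarrow> (INF x\<in>UNIV. g \<kappa> x) = 0 \<and> (g \<kappa> \<longlongrightarrow> 0) at_top) \<and>
         (\<kappa> > 1 \<longrightarrow> (INF x\<in>UNIV. g \<kappa> x) = 0 \<and> (g \<kappa> \<longlongrightarrow> 0) at_bot) \<and>
         (\<kappa> = 1 \<longrightarrow> (\<forall>x. g \<kappa> x = exp (- exp (- euler_mascheroni)) \<and>
                          exp (- exp (- euler_mascheroni)) > (1/2 :: real)))"
proof (intro conjI impI allI)
  assume "\<kappa> < 1"
  then show "(g \<kappa> \<longlongrightarrow> 0) at_top"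
    by (rule tendsto_g_0_at_top)
  then show "(INF x\<in>UNIV. g \<kappa> x) = 0"
    by (rule INF_g_eq_0_if_tendsto_0) simp
next
  assume "\<kappa> > 1"
  then show "(g \<kappa> \<longlongrightarrow> 0) at_bot"
    by (rule tendsto_g_0_at_bot)
  then show "(INF x\<in>UNIV. g \<kappa> x) = 0"
    by (rule INF_g_eq_0_if_tendsto_0) simp
next
  fix x
  assume "\<kappa> = 1"
  then show "g \<kappa> x = exp (- exp (- euler_mascheroni))"
    by (simp add: g_def)
  show "exp (- exp (- euler_mascheroni)) > (1/2 :: real)"
    using gumbel_cdf_euler_mascheroni_gt_half by (simp add: gumbel_cdf_def)
qed

end
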